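(* For every integer $n\ge3$ and for each of the orders $U>D>L$, $U>L>D$ and $L>U>D$ on step types, the descent map on $\mathbf M_n^*$ with respect to that order has a cyclic extension.
   Context: Write $[n]=\{1,\dots,n\}$ and let $2^{X}$ denote the power set of $X$. Cyclic extension. Let $\mathcal F$ be a finite set with a map $\mathrm{Des}:\mathcal F\to 2^{[n-1]}$. A cyclic extension of $\mathrm{Des}$ is a pair $(\mathrm{cDes},p)$, where $\mathrm{cDes}:\mathcal F\to 2^{[n]}$ is a map and $p:\mathcal F\to\mathcal F$ is a bijection, such that for all $F\in\mathcal F$: (extension) $\mathrm{cDes}(F)\cap[n-1]=\mathrm{Des}(F)$; (equivariance) $\mathrm{cDes}(p(F))=\mathrm{cDes}(F)+1$, where $1$ is added to every element modulo $n$ (so $n$ becomes $1$); (non-Escher) $\varnothing\subsetneq \mathrm{cDes}(F)\subsetneq[n]$. A Motzkin path of length $n$ is a lattice path from $(0,0)$ to $(n,0)$ with steps $U=(1,1)$, $D=(1,-1)$, $L=(1,0)$ that never passes below the $x$-axis. $\mathbf M_n$ is the set of Motzkin paths of length $n$, and $\mathbf M_n^*=\mathbf M_n\setminus\{L^n\}$, where $L^n$ is the path all of whose steps are $L$. For a total order on the step types $U,D,L$, the descent map with respect to that order sends $M$ to the set of $i\in[n-1]$ such that the $i$th step of $M$ is strictly larger in the order than the $(i+1)$st step. *)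

theory Defs
  imports Main "HOL-Library.Product_Plus"
begin

subsection \<open>Cyclic extensions of a descent map\<close>

text \<open>Adds 1 modulo \<open>n\<close>, with representatives \<open>{1..n}\<close>: here \<open>i mod n + 1\<close> is \<open>i + 1\<close> for
  \<open>1 \<le> i < n\<close>, and it is \<open>1\<close> for \<open>i = n\<close>.\<close>
definition cyclic_shift :: "nat \<Rightarrow> nat set \<Rightarrow> nat set" where
  "cyclic_shift n S = (\<lambda>i. i mod n + 1) ` S"

text \<open>The first two conjuncts are the standing assumptions on the set and on \<open>Des\<close>. The maps are total
  functions of which only the values on \<open>F\<close> matter.\<close>
definition is_cyclic_extension ::
  "nat \<Rightarrow> 'a set \<Rightarrow> ('a \<Rightarrow> nat set) \<Rightarrow> ('a \<Rightarrow> nat set) \<Rightarrow> ('a \<Rightarrow> 'a) \<Rightarrow> bool" where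
  "is_cyclic_extension n F Des cDes p \<longleftrightarrow>
     finite F \<and> (\<forall>x\<in>F. Des x \<subseteq> {1..n-1}) \<and>
     (\<forall>x\<in>F. cDes x \<subseteq> {1..n}) \<and> bij_betw p F F \<and>
     (\<forall>x\<in>F. cDes x \<inter> {1..n-1} = Des x \<and>
            cDes (p x) = cyclic_shift n (cDes x) \<and>
            {} \<subset> cDes x \<and> cDes x \<subset> {1..n})"

definition has_cyclic_extension :: "nat \<Rightarrow> 'a set \<Rightarrow> ('a \<Rightarrow> nat set) \<Rightarrow> bool" where
  "has_cyclic_extension n F Des \<longleftrightarrow> (\<exists>cDes p. is_cyclic_extension n F Des cDes p)"

subsection \<open>Motzkin paths\<close>

datatype step = U | D | L

fun step_vec :: "step \<Rightarrow> int \<times> int" where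
  "step_vec U = (1, 1)"
| "step_vec D = (1, -1)"
| "step_vec L = (1, 0)"

text \<open>A lattice path starting at the origin is given by its list of steps.\<close>
definition endpoint :: "step list \<Rightarrow> int \<times> int" where
  "endpoint w = sum_list (map step_vec w)"

definition motzkin_paths :: "nat \<Rightarrow> step list set" where
  "motzkin_paths n =
     {w. endpoint w = (int n, 0) \<and> (\<forall>k\<le>length w. 0 \<le> snd (endpoint (take k w)))}"

lemma length_motzkin_path:
  assumes "w \<in> motzkin_paths n"
  shows "length w = n"
proof -
  have "fst (step_vec s) = 1" for s
    by (cases s) auto
  then have "fst (endpoint w) = int (length w)"
    by (induction w) (auto simp: endpoint_def)
  with assms show ?thesis
    by (simp add: motzkin_paths_def)
qed

definition motzkin_paths_star :: "nat \<Rightarrow> step list set" where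
  "motzkin_paths_star n = motzkin_paths n - {replicate n L}"

subsection \<open>Descents with respect to an order on the step types\<close>

text \<open>\<open>chain_gt a b c\<close> is the strict relation ``greater than'' of the total order \<open>a > b > c\<close>.\<close>
definition chain_gt :: "step \<Rightarrow> step \<Rightarrow> step \<Rightarrow> step \<Rightarrow> step \<Rightarrow> bool" where
  "chain_gt a b c s t \<longleftrightarrow> (s, t) \<in> {(a, b), (a, c), (b, c)}"

text \<open>List positions are counted from 0, so the \<open>i\<close>th step is \<open>w ! (i - 1)\<close>.\<close>
definition descents :: "(step \<Rightarrow> step \<Rightarrow> bool) \<Rightarrow> nat \<Rightarrow> step list \<Rightarrow> nat set" where
  "descents gt n w = {i \<in> {1..n-1}. gt (w ! (i - 1)) (w ! i)}"

end

theory Submission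
  imports Defs "HOL-Library.Multiset"
begin

text \<open>
  For the order \<open>L > U > D\<close>, read a Motzkin path as a noncrossing partial matching of \<open>n\<close> points on
  a circle: each \<open>U\<close> is matched with the \<open>D\<close> that closes it, and the \<open>L\<close> are unmatched. A descent is
  then an unmatched point followed by a matched one, or an arc joining two neighbours. Both notions
  are rotation invariant, so rotating the circle gives the cyclic extension.

  The distribution of the descent set over the paths is the same for all three orders: a word with
  descent set contained in \<open>J\<close> is obtained by sorting the letters within each of the segments cut out by
  \<open>J\<close>, and as long as \<open>U > D\<close> the choice of the order does not affect the subword of the \<open>U\<close> and
  \<open>D\<close>, hence not the Motzkin condition. Moebius inversion over \<open>J\<close> and a descent preserving bijection
  transfer the cyclic extension to the other orders.
\<close>

subsection \<open>Transfer of cyclic extensions\<close>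

text \<open>Pull \<open>cDes\<close> back along \<open>f\<close> and conjugate \<open>p\<close> by
  \<open>f\<close>.\<close>

lemma has_cyclic_extension_transfer:
  assumes ext: "has_cyclic_extension n F Des"
    and f: "bij_betw f F' F" and Des: "\<And>x. x \<in> F' \<Longrightarrow> Des (f x) = Des' x"
  shows "has_cyclic_extension n F' Des'"
proof -
  from ext obtain cDes p where e: "is_cyclic_extension n F Des cDes p"
    by (auto simp: has_cyclic_extension_def)
  define g where "g = inv_into F' f"
  have g: "bij_betw g F F'"
    unfolding g_def by (rule bij_betw_inv_into[OF f])
  have fg: "f (g y) = y" if "y \<in> F" for y
    using that f by (simp add: g_def bij_betw_inv_into_right)
  have fF: "f x \<in> F" if "x \<in> F'" for x
    using that f bij_betwE by blast
  have p: "bij_betw p F F"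
    using e by (simp add: is_cyclic_extension_def)
  have pF: "p y \<in> F" if "y \<in> F" for y
    using that p bij_betwE by blast
  have "bij_betw (g \<circ> (p \<circ> f)) F' F'"
    by (rule bij_betw_trans[OF bij_betw_trans[OF f p] g])
  moreover have "finite F'"
    using e f by (simp add: is_cyclic_extension_def bij_betw_finite)
  ultimately have "is_cyclic_extension n F' Des' (cDes \<circ> f) (g \<circ> (p \<circ> f))"
    using e fF Des unfolding is_cyclic_extension_def
    by (simp add: fg pF flip: Des)
  then show ?thesis
    by (auto simp: has_cyclic_extension_def)
qed

lemma bij_betw_of_card_fibres_eq:
  assumes "finite A" "finite B"
    and eq: "\<And>J. card {x \<in> A. f x = J} = card {y \<in> B. g y = J}"
  shows "\<exists>h. bij_betw h A B \<and> (\<forall>x\<in>A. g (h x) = f x)"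
proof -
  have "\<exists>h. bij_betw h {x \<in> A. f x = J} {y \<in> B. g y = J}" for J
    by (rule finite_same_card_bij) (use assms in auto)
  then obtain H where H: "\<And>J. bij_betw (H J) {x \<in> A. f x = J} {y \<in> B. g y = J}"
    by metis
  define h where "h x = H (f x) x" for x
  have hB: "h x \<in> B \<and> g (h x) = f x" if "x \<in> A" for x
    using bij_betwE[OF H[of "f x"]] that by (auto simp: h_def)
  have "inj_on h A"
  proof (rule inj_onI)
    fix x y assume xy: "x \<in> A" "y \<in> A" "h x = h y"
    then have "f x = f y"
      using hB by metis
    with xy show "x = y"
      using bij_betw_imp_inj_on[OF H[of "f y"]] by (auto simp: h_def inj_on_def)
  qed
  moreover have "B \<subseteq> h ` A"
  proof
    fix y assume "y \<in> B"
    then have "y \<in> H (g y) ` {x \<in> A. f x = g y}"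
      using bij_betw_imp_surj_on[OF H[of "g y"]] by auto
    then obtain x where "x \<in> A" "y = h x"
      by (auto simp: h_def)
    then show "y \<in> h ` A"
      by blast
  qed
  ultimately have "bij_betw h A B"
    using hB by (auto simp: bij_betw_def)
  with hB show ?thesis
    by blast
qed

section \<open>Moebius inversion over descent sets\<close>

lemma card_subset_fibres_split:
  assumes "finite A" "finite J"
  shows "card {x \<in> A. f x \<subseteq> J} =
      card {x \<in> A. f x = J} + (\<Sum>K\<in>Pow J - {J}. card {x \<in> A. f x = K})"
proof -
  have "{x \<in> A. f x \<subseteq> J} = (\<Union>K\<in>Pow J. {x \<in> A. f x = K})"
    by auto
  also have "card \<dots> = (\<Sum>K\<in>Pow J. card {x \<in> A. f x = K})"
    by (rule card_UN_disjoint) (use assms in auto)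
  finally show ?thesis
    using assms by (simp add: sum.remove[of "Pow J" J])
qed

text \<open>Moebius inversion as induction on \<open>J\<close>: the fibres over proper subsets agree
  already and the total over all subsets is given, which forces the term at
  \<open>J\<close>.\<close>

lemma card_fibres_eq_of_card_subset_eq:
  assumes "finite A" "finite B" "finite J"
    and eq: "\<And>J. card {x \<in> A. f x \<subseteq> J} = card {y \<in> B. g y \<subseteq> J}"
  shows "card {x \<in> A. f x = J} = card {y \<in> B. g y = J}"
  using \<open>finite J\<close>
proof (induction J rule: finite_psubset_induct)
  case (psubset J)
  have "(\<Sum>K\<in>Pow J - {J}. card {x \<in> A. f x = K}) = (\<Sum>K\<in>Pow J - {J}. card {y \<in> B. g y = K})"
    by (rule sum.cong) (use psubset.IH in auto)
  with card_subset_fibres_split[OF assms(1) psubset.hyps, of f]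
    card_subset_fibres_split[OF assms(2) psubset.hyps, of g] eq[of J] show ?case
    by simp
qed

subsection \<open>Motzkin words\<close>

text \<open>The starting height is a parameter so that the recursion can peel off first steps. As
  heights are natural numbers, only a \<open>D\<close> can violate the bound by the axis.\<close>

fun motzkin_from :: "nat \<Rightarrow> step list \<Rightarrow> bool" where
  "motzkin_from h [] = (h = 0)"
| "motzkin_from h (U # w) = motzkin_from (Suc h) w"
| "motzkin_from h (D # w) = (case h of 0 \<Rightarrow> False | Suc k \<Rightarrow> motzkin_from k w)"
| "motzkin_from h (L # w) = motzkin_from h w"

lemma all_le_Suc_split: "(\<forall>k\<le>Suc m. P k) \<longleftrightarrow> P 0 \<and> (\<forall>k\<le>m. P (Suc k))"
  using All_less_Suc2[of "Suc m" P] by (simp add: less_Suc_eq_le)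

lemma motzkin_from_iff:
  "motzkin_from h w \<longleftrightarrow>
     int h + snd (endpoint w) = 0 \<and> (\<forall>k\<le>length w. 0 \<le> int h + snd (endpoint (take k w)))"
proof (induction w arbitrary: h)
  case Nil
  then show ?case by (simp add: endpoint_def)
next
  case (Cons s w)
  have e: "snd (endpoint (t # v)) = snd (step_vec t) + snd (endpoint v)" for t v
    by (simp add: endpoint_def)
  have e0: "endpoint [] = 0"
    by (simp add: endpoint_def)
  show ?case
  proof (cases s)
    case U
    then show ?thesis
      by (simp add: Cons.IH all_le_Suc_split e e0 algebra_simps)
  next
    case D
    show ?thesis
    proof (cases h)
      case 0
      have "0 \<le> length w" by simp
      with D 0 show ?thesis
        by (auto simp: all_le_Suc_split e e0 dest!: spec[of _ 0])
    next
      case (Suc k)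
      with D show ?thesis
        by (simp add: Cons.IH all_le_Suc_split e e0 algebra_simps)
    qed
  next
    case L
    then show ?thesis
      by (simp add: Cons.IH all_le_Suc_split e e0 algebra_simps)
  qed
qed

lemma fst_endpoint: "fst (endpoint w) = int (length w)"
proof -
  have "fst (step_vec s) = 1" for s
    by (cases s) auto
  then show ?thesis
    by (induction w) (auto simp: endpoint_def)
qed

lemma motzkin_paths_eq: "motzkin_paths n = {w. length w = n \<and> motzkin_from 0 w}"
  by (auto simp: motzkin_paths_def motzkin_from_iff fst_endpoint prod_eq_iff)

lemma motzkin_paths_star_eq:
  "motzkin_paths_star n = {w. length w = n \<and> motzkin_from 0 w \<and> \<not> set w \<subseteq> {L}}"
proof -
  have "w = replicate (length w) L \<longleftrightarrow> set w \<subseteq> {L}" for w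
    by (induction w) auto
  then show ?thesis
    by (auto simp: motzkin_paths_star_def motzkin_paths_eq)
qed

lemma finite_motzkin_paths_star: "finite (motzkin_paths_star n)"
proof -
  have "s \<in> {U, D, L}" for s
    by (cases s) auto
  then have "motzkin_paths_star n \<subseteq> {w. set w \<subseteq> {U, D, L} \<and> length w = n}"
    by (auto simp: motzkin_paths_star_eq)
  then show ?thesis
    by (rule finite_subset) (simp add: finite_lists_length_eq)
qed

section \<open>Concatenation and decomposition at matched steps\<close>

lemma motzkin_from_append:
  "motzkin_from h x \<Longrightarrow> motzkin_from (h + k) (x @ y) \<longleftrightarrow> motzkin_from k y"
  by (induction h x arbitrary: k rule: motzkin_from.induct) (auto split: nat.splits)

lemma motzkin_append [simp]: "motzkin_from 0 x \<Longrightarrow> motzkin_from h (x @ y) \<longleftrightarrow> motzkin_from h y"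
  using motzkin_from_append[of 0 x h y] by simp

text \<open>Level steps keep the height. Hence the later sorting, which moves \<open>L\<close> past
  \<open>U\<close> and \<open>D\<close>, respects the Motzkin condition.\<close>

lemma motzkin_from_filter: "motzkin_from h (filter (\<lambda>s. s \<noteq> L) w) \<longleftrightarrow> motzkin_from h w"
  by (induction h w rule: motzkin_from.induct) (auto split: nat.splits)

text \<open>The \<open>D\<close> found is the first step that reaches height
  \<open>h\<close>.\<close>

lemma motzkin_from_Suc_decomp:
  assumes "motzkin_from (Suc h) w"
  obtains x y where "w = x @ D # y" "motzkin_from 0 x" "motzkin_from h y"
  using assms
proof (induction "length w" arbitrary: h w thesis rule: less_induct)
  case less
  show ?case
  proof (cases w)
    case Nil
    with less.prems show ?thesis by simp
  next
    case (Cons s v)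
    show ?thesis
    proof (cases s)
      \<comment> \<open>From one level higher two first passages are needed: one closes this
        \<open>U\<close>, the next is the required \<open>D\<close>.\<close>
      case U
      with Cons less.prems have "motzkin_from (Suc (Suc h)) v" by simp
      with less.hyps[of v] Cons obtain x y where
        xy: "v = x @ D # y" "motzkin_from 0 x" "motzkin_from (Suc h) y" by auto
      with less.hyps[of y] Cons obtain x' y' where
        "y = x' @ D # y'" "motzkin_from 0 x'" "motzkin_from h y'" by auto
      with U Cons xy less.prems(1)[of "U # x @ D # x'" y'] show ?thesis
        by simp
    next
      case D
      with Cons less.prems(2) less.prems(1)[of "[]" v] show ?thesis by simp
    next
      case L
      obtain x y where "v = x @ D # y" "motzkin_from 0 x" "motzkin_from h y"
        by (rule less.hyps[of v h]) (use Cons L less.prems(2) in auto)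
      with Cons L less.prems(1)[of "L # x" y] show ?thesis by simp
    qed
  qed
qed

text \<open>The \<open>U\<close> found is the partner of the final \<open>D\<close>. Level steps and
  arcs closed earlier are peeled off the front into \<open>x\<close> until that partner comes
  first.\<close>

lemma motzkin_last_decomp:
  assumes "motzkin_from 0 (w @ [D])"
  obtains x y where "w = x @ U # y" "motzkin_from 0 x" "motzkin_from 0 y"
  using assms
proof (induction "length w" arbitrary: w thesis rule: less_induct)
  case less
  show ?case
  proof (cases w)
    case Nil
    with less.prems show ?thesis by simp
  next
    case (Cons s v)
    show ?thesis
    proof (cases s)
      case U
      with Cons less.prems have "motzkin_from (Suc 0) (v @ [D])" by simp
      then obtain x y where xy: "v @ [D] = x @ D # y" "motzkin_from 0 x" "motzkin_from 0 y"
        by (rule motzkin_from_Suc_decomp)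
      show ?thesis
      proof (cases y rule: rev_cases)
        case Nil
        with xy Cons U less.prems(1)[of "[]" x] show ?thesis by simp
      next
        case (snoc y' t)
        with xy have y': "v = x @ D # y'" "motzkin_from 0 (y' @ [D])" by auto
        with less.hyps[of y'] Cons obtain x2 y2 where
          "y' = x2 @ U # y2" "motzkin_from 0 x2" "motzkin_from 0 y2" by auto
        with xy y' Cons U less.prems(1)[of "U # x @ D # x2" y2] show ?thesis by simp
      qed
    next
      case D
      with Cons less.prems(2) show ?thesis by simp
    next
      case L
      obtain x y where "v = x @ U # y" "motzkin_from 0 x" "motzkin_from 0 y"
        by (rule less.hyps[of v]) (use Cons L less.prems(2) in auto)
      with Cons L less.prems(1)[of "L # x" y] show ?thesis by simp
    qed
  qed
qed

text \<open>Otherwise one of \<open>x\<close>, \<open>x'\<close> would extend the other by a word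
  starting with \<open>D\<close>, a step below the axis.\<close>

lemma motzkin_first_return_unique:
  assumes "x @ D # y = x' @ D # y'" "motzkin_from 0 x" "motzkin_from 0 x'"
  shows "x = x' \<and> y = y'"
proof -
  have no: "\<not> motzkin_from 0 (v @ D # z)" if "motzkin_from 0 v" for v z
    using that by simp
  have "x = x'"
    using assms(1) unfolding append_eq_append_conv2
    by (metis (no_types, lifting) append_Nil2 append_eq_Cons_conv assms(2,3) no)
  with assms(1) show ?thesis by simp
qed

lemma motzkin_last_return_unique:
  assumes eq: "x @ U # y = x' @ U # y'"
    and m: "motzkin_from 0 x" "motzkin_from 0 y" "motzkin_from 0 x'" "motzkin_from 0 y'"
  shows "x = x' \<and> y = y'"
proof -
  \<comment> \<open>This is the situation of two different cuts. Since \<open>U # z\<close> ends at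
    height 0, \<open>z\<close> by itself passes below the axis, so no word starting with
    \<open>z\<close> is Motzkin.\<close>
  have no: False if "motzkin_from 0 (v @ U # z)" "motzkin_from 0 v" "motzkin_from 0 (z @ U # t)"
    for v z t
  proof -
    from that have "motzkin_from (Suc 0) z" by simp
    then obtain a b where "z = a @ D # b" "motzkin_from 0 a"
      by (rule motzkin_from_Suc_decomp)
    with that(3) show False by simp
  qed
  from eq consider "x = x'" "y = y'" | z where "x' = x @ U # z" "y = z @ U # y'"
    | z where "x = x' @ U # z" "y' = z @ U # y"
    unfolding append_eq_append_conv2 by (metis append_Nil2 append_eq_Cons_conv append_Nil list.inject)
  then show ?thesis
    by cases (use no m in blast)+
qed

lemma motzkin_butlast_L: "motzkin_from h (w @ [L]) \<Longrightarrow> motzkin_from h w"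
  by (induction h w rule: motzkin_from.induct) (auto split: nat.splits)

lemma motzkin_hd: "motzkin_from 0 (s # w) \<Longrightarrow> s \<noteq> D"
  by auto

lemma motzkin_last: "\<not> motzkin_from h (w @ [U])"
  by (induction h w rule: motzkin_from.induct) (auto split: nat.splits)

subsection \<open>Rotation of Motzkin words\<close>

text \<open>The last point moves to the front; if it closes the arc started by some \<open>U\<close>, that arc now runs
  from the first point to the old partner shifted by one.\<close>
inductive rotation :: "step list \<Rightarrow> step list \<Rightarrow> bool" where
  level: "motzkin_from 0 w \<Longrightarrow> rotation (w @ [L]) (L # w)"
| arc: "motzkin_from 0 x \<Longrightarrow> motzkin_from 0 y \<Longrightarrow> rotation (x @ U # y @ [D]) (U # x @ D # y)"

lemma rotation_exists:
  assumes "motzkin_from 0 w" "w \<noteq> []"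
  obtains w' where "rotation w w'"
proof -
  from assms(2) obtain v s where w: "w = v @ [s]"
    by (cases w rule: rev_cases) auto
  show ?thesis
  proof (cases s)
    case U
    with w assms(1) motzkin_last show ?thesis by simp
  next
    case D
    with w assms(1) obtain x y where "v = x @ U # y" "motzkin_from 0 x" "motzkin_from 0 y"
      using motzkin_last_decomp by metis
    with w D that arc show ?thesis by fastforce
  next
    case L
    with w that level assms(1) motzkin_butlast_L show ?thesis by blast
  qed
qed

lemma rotation_mset: "rotation w w' \<Longrightarrow> mset w' = mset w"
  by (induction rule: rotation.induct) auto

lemma rotation_motzkin: "rotation w w' \<Longrightarrow> motzkin_from 0 w'"
  by (induction rule: rotation.induct) simp_all

text \<open>The first letter of the image reveals the rule applied, and for \<open>arc\<close> its
  first return recovers \<open>x\<close> and \<open>y\<close>.\<close>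

lemma rotation_inj:
  assumes "rotation v w" "rotation v' w"
  shows "v = v'"
  using assms(1)
proof cases
  case (level z)
  from assms(2) show ?thesis
    by cases (use level in auto)
next
  case (arc x y)
  from assms(2) obtain x' y' where v': "v' = x' @ U # y' @ [D]" "w = U # x' @ D # y'"
      "motzkin_from 0 x'"
    by cases (use arc in auto)
  then have "x = x' \<and> y = y'"
    by (intro motzkin_first_return_unique) (use arc in simp_all)
  with arc v' show ?thesis
    by simp
qed

lemma rotation_functional:
  assumes "rotation v w" "rotation v w'"
  shows "w = w'"
  using assms(1)
proof cases
  case (level z)
  from assms(2) show ?thesis
    by cases (use level in auto)
next
  case (arc x y)
  have "last v = D"
    using arc by simp
  from assms(2) obtain x' y' where v: "v = (x' @ U # y') @ [D]" "w' = U # x' @ D # y'"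
      "motzkin_from 0 x'" "motzkin_from 0 y'"
    by cases (use \<open>last v = D\<close> in auto)
  then have "(x @ U # y) @ [D] = (x' @ U # y') @ [D]"
    using arc by simp
  then have "x @ U # y = x' @ U # y'"
    unfolding append1_eq_conv by (rule conjunct1)
  then have "x = x' \<and> y = y'"
    by (rule motzkin_last_return_unique) (use arc v in simp_all)
  with arc v show ?thesis
    by simp
qed

section \<open>Descents of rotated words, as indicator lists\<close>

fun descent_word :: "(step \<Rightarrow> step \<Rightarrow> bool) \<Rightarrow> step list \<Rightarrow> bool list" where
  "descent_word gt (s # t # w) = gt s t # descent_word gt (t # w)"
| "descent_word gt _ = []"

lemma length_descent_word [simp]: "length (descent_word gt w) = length w - 1"
  by (induction gt w rule: descent_word.induct) auto

lemma nth_descent_word: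
  "Suc i < length w \<Longrightarrow> descent_word gt w ! i \<longleftrightarrow> gt (w ! i) (w ! Suc i)"
  by (induction gt w arbitrary: i rule: descent_word.induct) (auto simp: nth_Cons split: nat.splits)

lemma descent_word_append:
  "descent_word gt (x @ s # y) = descent_word gt (x @ [s]) @ descent_word gt (s # y)"
proof (induction x)
  case (Cons a x)
  then show ?case by (cases x) auto
qed simp

text \<open>Descent positions count from 1, list entries from 0.\<close>

lemma mem_descents_iff:
  assumes "length w = n"
  shows "i \<in> descents gt n w \<longleftrightarrow> 1 \<le> i \<and> i < n \<and> descent_word gt w ! (i - 1)"
  using assms by (cases i) (auto simp: descents_def nth_descent_word)

abbreviation "gtLUD \<equiv> chain_gt L U D"

text \<open>A nonempty Motzkin word ends in \<open>L\<close>, which exceeds both \<open>U\<close>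
  and \<open>D\<close>, or in \<open>D\<close>, which exceeds neither. With the next lemma, the
  replacement of \<open>U\<close> by \<open>D\<close> in \<open>arc\<close> becomes invisible to
  descents.\<close>

lemma descent_word_before_D:
  assumes "motzkin_from 0 x"
  shows "descent_word gtLUD (x @ [U]) = descent_word gtLUD (x @ [D])"
proof (cases x rule: rev_cases)
  case (snoc v s)
  with assms motzkin_last have "s \<noteq> U" by auto
  then have "gtLUD s U = gtLUD s D"
    by (cases s) (auto simp: chain_gt_def)
  with snoc show ?thesis
    using descent_word_append[of gtLUD v s "[U]"] descent_word_append[of gtLUD v s "[D]"] by simp
qed simp

text \<open>The first letter of \<open>y\<close> is \<open>U\<close> or \<open>L\<close>, and
  neither \<open>U\<close> nor \<open>D\<close> exceeds it.\<close>

lemma descent_word_after_U: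
  assumes "motzkin_from 0 y"
  shows "descent_word gtLUD (U # y) = descent_word gtLUD (D # y)"
proof (cases y)
  case (Cons s v)
  with assms motzkin_hd have "s \<noteq> D" by auto
  with Cons show ?thesis
    by (cases s) (auto simp: chain_gt_def)
qed simp

text \<open>Rotation moves descents one place to the right. Without its last letter the word is kept
  by \<open>level\<close>, and changed by \<open>arc\<close> from \<open>x @ U # y\<close> to
  \<open>x @ D # y\<close>, which the two preceding lemmas absorb.\<close>

lemma rotation_descent_word:
  assumes "rotation w w'" "length w \<ge> 2"
  shows "descent_word gtLUD w' = hd (descent_word gtLUD w') # butlast (descent_word gtLUD w)"
  using assms
proof cases
  case (level v)
  with assms(2) obtain s u where "v = u @ [s]" by (cases v rule: rev_cases) auto
  moreover have "descent_word gtLUD (u @ [s, L]) = descent_word gtLUD (u @ [s]) @ [gtLUD s L]"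
    using descent_word_append[of gtLUD u s "[L]"] by simp
  moreover have "\<exists>b. descent_word gtLUD (L # u @ [s]) = b # descent_word gtLUD (u @ [s])"
    by (cases u) auto
  ultimately show ?thesis using level by auto
next
  case (arc x y)
  have "\<exists>b. descent_word gtLUD (U # y @ [D]) = descent_word gtLUD (U # y) @ [b]"
  proof (cases y rule: rev_cases)
    case (snoc u s)
    then show ?thesis
      using descent_word_append[of gtLUD "U # u" s "[D]"] by simp
  qed simp
  then obtain b where b: "descent_word gtLUD (U # y @ [D]) = descent_word gtLUD (U # y) @ [b]" ..
  obtain c where c: "descent_word gtLUD (U # x @ [D]) = c # descent_word gtLUD (x @ [D])"
    by (cases x) auto
  show ?thesis
    using descent_word_append[of gtLUD x U "y @ [D]"] descent_word_append[of gtLUD "U # x" D y]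
      arc b c descent_word_before_D[of x] descent_word_after_U[of y]
    by (simp add: butlast_append)
qed

text \<open>Two rotations bring the last two points to the front. The cases run through their types:
  a descent occurs just for an unmatched point before a matched one, or for an arc joining the
  two.\<close>

lemma rotation_twice_descent:
  assumes r: "rotation w w'" "rotation w' w''" and len: "length w \<ge> 2"
  shows "hd (descent_word gtLUD w'') \<longleftrightarrow> last (descent_word gtLUD w)"
  using r(1)
proof cases
  case (level v)
  with len obtain s u where v: "v = u @ [s]" by (cases v rule: rev_cases) auto
  have "\<not> last (descent_word gtLUD w)"
    using level v descent_word_append[of gtLUD u s "[L]"] by (auto simp: chain_gt_def)
  moreover have "\<not> hd (descent_word gtLUD w'')"
  proof (cases s)
    case U
    with level v motzkin_last show ?thesis by simp
  next
    case D
    with level v obtain x y where xy: "u = x @ U # y" "motzkin_from 0 x" "motzkin_from 0 y"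
      using motzkin_last_decomp by metis
    then have "rotation w' (U # (L # x) @ D # y)"
      using level v D rotation.arc[of "L # x" y] by simp
    with r(2) have "w'' = U # L # x @ D # y"
      using rotation_functional by fastforce
    then show ?thesis by (simp add: chain_gt_def)
  next
    case L
    with level v have "rotation w' (L # L # u)"
      using rotation.level[of "L # u"] motzkin_butlast_L[of 0 u] by simp
    with r(2) have "w'' = L # L # u"
      using rotation_functional by blast
    then show ?thesis by (simp add: chain_gt_def)
  qed
  ultimately show ?thesis by simp
next
  case (arc x y)
  have x1: "motzkin_from (Suc 0) (x @ D # z) \<longleftrightarrow> motzkin_from 0 z" for z
    using arc by simp
  show ?thesis
  proof (cases y rule: rev_cases)
    case Nil
    with arc have "last (descent_word gtLUD w)"
      using descent_word_append[of gtLUD x U "[D]"] by (simp add: chain_gt_def)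
    moreover have "rotation w' (U # D # x)"
      using arc Nil rotation.arc[of "[]" x] by simp
    then have "w'' = U # D # x"
      using r(2) rotation_functional by blast
    then have "hd (descent_word gtLUD w'')"
      by (simp add: chain_gt_def)
    ultimately show ?thesis by simp
  next
    case (snoc u s)
    have last: "last (descent_word gtLUD w) \<longleftrightarrow> gtLUD s D"
      using arc snoc descent_word_append[of gtLUD "x @ U # u" s "[D]"] by simp
    show ?thesis
    proof (cases s)
      case U
      with arc snoc motzkin_last show ?thesis by simp
    next
      case D
      with arc snoc obtain a b where ab: "u = a @ U # b" "motzkin_from 0 a" "motzkin_from 0 b"
        using motzkin_last_decomp by metis
      then have "rotation w' (U # (U # x @ D # a) @ D # b)"
        using arc snoc D x1 rotation.arc[of "U # x @ D # a" b] by simp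
      with r(2) have "w'' = U # (U # x @ D # a) @ D # b"
        using rotation_functional by blast
      with last D show ?thesis by (simp add: chain_gt_def)
    next
      case L
      with arc snoc have "rotation w' (L # U # x @ D # u)"
        using rotation.level[of "U # x @ D # u"] motzkin_butlast_L[of 0 u] x1 by simp
      with r(2) have "w'' = L # U # x @ D # u"
        using rotation_functional by blast
      with last L show ?thesis by (simp add: chain_gt_def)
    qed
  qed
qed

section \<open>Rotation as a permutation of the paths\<close>

definition rotate_word :: "step list \<Rightarrow> step list" where
  "rotate_word w = (SOME w'. rotation w w')"

lemma rotation_rotate_word:
  assumes "w \<in> motzkin_paths_star n"
  shows "rotation w (rotate_word w)"
proof -
  have "\<exists>w'. rotation w w'"
    using assms rotation_exists[of w] by (cases "w = []") (auto simp: motzkin_paths_star_eq)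
  then show ?thesis
    unfolding rotate_word_def by (rule someI_ex)
qed

lemma rotate_word_mem:
  assumes "w \<in> motzkin_paths_star n"
  shows "rotate_word w \<in> motzkin_paths_star n"
  using assms rotation_motzkin[OF rotation_rotate_word[OF assms]]
    mset_eq_length[OF rotation_mset[OF rotation_rotate_word[OF assms]]]
    mset_eq_setD[OF rotation_mset[OF rotation_rotate_word[OF assms]]]
  by (simp add: motzkin_paths_star_eq)

lemma bij_betw_rotate_word:
  "bij_betw rotate_word (motzkin_paths_star n) (motzkin_paths_star n)"
proof -
  have "inj_on rotate_word (motzkin_paths_star n)"
    by (rule inj_onI) (metis rotation_inj rotation_rotate_word)
  moreover have "rotate_word ` motzkin_paths_star n \<subseteq> motzkin_paths_star n"
    using rotate_word_mem by blast
  ultimately show ?thesis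
    by (simp add: bij_betw_def endo_inj_surj finite_motzkin_paths_star)
qed

text \<open>Here \<open>s\<close> is the letter preceding \<open>w\<close>. A \<open>D\<close> after
  \<open>U\<close> or \<open>L\<close> would be a descent, so no \<open>D\<close> occurs in
  \<open>w\<close>; the path cannot come down, which excludes positive heights and any
  \<open>U\<close>.\<close>

lemma motzkin_descent_free:
  assumes "\<forall>b \<in> set (descent_word gtLUD (s # w)). \<not> b" "s \<noteq> D" "motzkin_from h w"
  shows "h = 0 \<and> set w \<subseteq> {L}"
  using assms
proof (induction w arbitrary: s h)
  case (Cons t w)
  show ?case
  proof (cases t)
    case U
    with Cons.prems have "motzkin_from (Suc h) w" "\<forall>b \<in> set (descent_word gtLUD (t # w)). \<not> b"
      by auto
    with Cons.IH[of t "Suc h"] U show ?thesis by simp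
  next
    case D
    with Cons.prems show ?thesis
      by (cases s) (auto simp: chain_gt_def)
  next
    case L
    with Cons.prems Cons.IH[of t h] show ?thesis by auto
  qed
qed simp

lemma motzkin_has_descent:
  assumes "w \<in> motzkin_paths_star n"
  shows "descents gtLUD n w \<noteq> {}"
proof
  assume "descents gtLUD n w = {}"
  then have "Suc i \<notin> descents gtLUD n w" for i
    by simp
  moreover have "length w = n"
    using assms by (simp add: motzkin_paths_star_eq)
  ultimately have nb: "\<forall>b \<in> set (descent_word gtLUD w). \<not> b"
    by (auto simp: mem_descents_iff in_set_conv_nth)
  from assms obtain s v where w: "w = s # v"
    by (cases w) (auto simp: motzkin_paths_star_eq)
  have m: "motzkin_from 0 (s # v)" "\<not> set (s # v) \<subseteq> {L}"
    using assms w by (simp_all add: motzkin_paths_star_eq)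
  have "s \<noteq> D"
    using motzkin_hd[OF m(1)] .
  with nb w have free: "motzkin_from h v \<Longrightarrow> h = 0 \<and> set v \<subseteq> {L}" for h
    using motzkin_descent_free by blast
  show False
  proof (cases s)
    case U
    with m(1) free[of "Suc 0"] show False by simp
  next
    case D
    with \<open>s \<noteq> D\<close> show False by simp
  next
    case L
    with m free[of 0] show False by simp
  qed
qed

section \<open>The cyclic extension for \<open>L > U > D\<close>\<close>

lemma cyclic_extension_LUD:
  assumes n: "n \<ge> 3"
  shows "has_cyclic_extension n (motzkin_paths_star n) (descents gtLUD n)"
proof -
  let ?M = "motzkin_paths_star n" and ?Des = "descents gtLUD n"
  \<comment> \<open>A descent from the last point of the circle to the first is visible as a descent
    at 1 after one rotation.\<close>
  define cDes where "cDes w = ?Des w \<union> (if 1 \<in> ?Des (rotate_word w) then {n} else {})" for w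
  have len: "length w = n" if "w \<in> ?M" for w
    using that by (simp add: motzkin_paths_star_eq)
  have Des_le: "?Des w \<subseteq> {1..n-1}" for w
    by (auto simp: descents_def)
  have inner: "Suc i \<in> ?Des (rotate_word w) \<longleftrightarrow> i \<in> ?Des w"
    if "w \<in> ?M" "1 \<le> i" "Suc i < n" for w i
  proof -
    have "descent_word gtLUD (rotate_word w) ! i = descent_word gtLUD w ! (i - 1)"
      using that len[of w] n
      by (subst rotation_descent_word[OF rotation_rotate_word[OF that(1)]])
        (auto simp: nth_Cons nth_butlast split: nat.splits)
    with that show ?thesis
      by (simp add: mem_descents_iff len rotate_word_mem)
  qed
  \<comment> \<open>The position \<open>n - 1\<close> has to move to \<open>n\<close>, and
    membership of \<open>n\<close> is tested after one further rotation.\<close>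
  have outer: "1 \<in> ?Des (rotate_word (rotate_word w)) \<longleftrightarrow> n - 1 \<in> ?Des w" if w: "w \<in> ?M" for w
  proof -
    have "descent_word gtLUD v \<noteq> []" if "v \<in> ?M" for v
      using len[OF that] n by (simp flip: length_greater_0_conv)
    moreover have "Suc 0 \<le> n - Suc 0"
      using n by simp
    ultimately show ?thesis
      using rotation_twice_descent[OF rotation_rotate_word[OF w]
        rotation_rotate_word[OF rotate_word_mem[OF w]]] n w
      by (simp add: mem_descents_iff len rotate_word_mem hd_conv_nth last_conv_nth)
  qed
  have eq: "cDes (rotate_word w) = cyclic_shift n (cDes w)" if w: "w \<in> ?M" for w
  proof -
    have shift: "cyclic_shift n (cDes w) =
        Suc ` ?Des w \<union> (if 1 \<in> ?Des (rotate_word w) then {1} else {})"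
      using Des_le[of w] by (force simp: cyclic_shift_def cDes_def image_Un)
    show ?thesis
    proof (rule set_eqI)
      fix i
      consider "i = 0 \<or> i > n" | "i = 1" | j where "i = Suc j" "1 \<le> j" "Suc j < n" | "i = n"
        by (cases i) force+
      then show "i \<in> cDes (rotate_word w) \<longleftrightarrow> i \<in> cyclic_shift n (cDes w)"
      proof cases
        case 1
        then show ?thesis
          unfolding shift using n Des_le[of w] Des_le[of "rotate_word w"]
          by (auto simp: cDes_def)
      next
        case 2
        then show ?thesis
          unfolding shift using n Des_le[of w] by (auto simp: cDes_def)
      next
        case 3
        then show ?thesis
          unfolding shift using inner[OF w] by (auto simp: cDes_def)
      next
        case 4
        have "n \<notin> ?Des (rotate_word w)" using Des_le[of "rotate_word w"] n by auto
        moreover have "n \<in> Suc ` ?Des w \<longleftrightarrow> n - 1 \<in> ?Des w"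
          using n by (cases n) auto
        ultimately show ?thesis
          unfolding shift using 4 n outer[OF w] by (auto simp: cDes_def)
      qed
    qed
  qed
  \<comment> \<open>If all positions were cyclic descents, the rotated word would begin with two
    descents, hence with \<open>L > U > D\<close>. Its first letter \<open>L\<close> is the last one
    of \<open>w\<close>, but no descent at \<open>n - 1\<close> can end in the largest step.\<close>
  have proper: "cDes w \<noteq> {1..n}" if w: "w \<in> ?M" for w
  proof
    assume full: "cDes w = {1..n}"
    have head: "v ! 0 = L" if "v \<in> ?M" "1 \<in> ?Des v" "2 \<in> ?Des v" for v
      using that by (auto simp: descents_def chain_gt_def numeral_2_eq_2)
    have "?Des w = cDes w \<inter> {1..n-1}"
      using Des_le[of w] n by (auto simp: cDes_def)
    then have all: "?Des w = {1..n-1}"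
      using full by auto
    moreover have "1 \<in> ?Des (rotate_word w)"
      using full n Des_le[of w] by (auto simp: cDes_def split: if_splits)
    ultimately have "rotate_word w ! 0 = L"
      using all head[OF rotate_word_mem[OF w]] inner[OF w, of 1] n by (simp add: numeral_2_eq_2)
    with rotation_rotate_word[OF w] have "last w = L"
      by cases auto
    moreover have "n - 1 \<in> ?Des w"
      using all n by simp
    ultimately show False
      using len[OF w] n by (cases w rule: rev_cases) (auto simp: descents_def chain_gt_def nth_append)
  qed
  have "is_cyclic_extension n ?M ?Des cDes rotate_word"
    unfolding is_cyclic_extension_def
  proof (intro conjI ballI)
    fix w assume w: "w \<in> ?M"
    show "cDes w \<subseteq> {1..n}"
      using subset_trans[OF Des_le[of w], of "{1..n}"] n by (auto simp: cDes_def)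
    then show "cDes w \<subset> {1..n}"
      using proper[OF w] by blast
    show "cDes w \<inter> {1..n-1} = ?Des w"
      using Des_le[of w] n by (auto simp: cDes_def)
    show "{} \<subset> cDes w"
      using motzkin_has_descent[OF w] by (auto simp: cDes_def)
  qed (use Des_le finite_motzkin_paths_star bij_betw_rotate_word eq in auto)
  then show ?thesis
    by (auto simp: has_cyclic_extension_def)
qed

subsection \<open>Independence of the order\<close>

lemma sorted_map_inj_unique:
  assumes "mset xs = mset ys" "sorted (map k xs)" "sorted (map k ys)" "inj k"
  shows "xs = ys"
proof -
  have "map k xs = map k ys"
    using assms by (metis mset_map properties_for_sort)
  with \<open>inj k\<close> show ?thesis by simp
qed

text \<open>The position \<open>i\<close> (counted from 0) lies in the segment number \<open>card (J \<inter> {..i})\<close>.\<close>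
definition segments :: "nat set \<Rightarrow> nat \<Rightarrow> nat list" where
  "segments J n = map (\<lambda>i. card (J \<inter> {..i})) [0..<n]"

text \<open>The lexicographic order by segment, then rank, packed into one number; 3 exceeds every
  rank allowed by \<open>step_rank\<close>.\<close>

definition segment_key :: "(step \<Rightarrow> nat) \<Rightarrow> nat \<times> step \<Rightarrow> nat" where
  "segment_key r p = 3 * fst p + r (snd p)"

definition segment_sort :: "(step \<Rightarrow> nat) \<Rightarrow> nat set \<Rightarrow> step list \<Rightarrow> step list" where
  "segment_sort r J w = map snd (sort_key (segment_key r) (zip (segments J (length w)) w))"

text \<open>Numerical form of the total orders with \<open>U\<close> above \<open>D\<close>.\<close>

definition step_rank :: "(step \<Rightarrow> nat) \<Rightarrow> bool" where
  "step_rank r \<longleftrightarrow> inj r \<and> (\<forall>s. r s < 3) \<and> r D < r U"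

abbreviation rank_gt :: "(step \<Rightarrow> nat) \<Rightarrow> step \<Rightarrow> step \<Rightarrow> bool" where
  "rank_gt r \<equiv> \<lambda>s t. r t < r s"

lemma length_segments [simp]: "length (segments J n) = n"
  by (simp add: segments_def)

text \<open>A descent at \<open>i + 1\<close> compares the letters \<open>i\<close> and
  \<open>i + 1\<close> counted from 0, so a new segment starts exactly at the members of
  \<open>J\<close>.\<close>

lemma segments_Suc:
  assumes "Suc i < n"
  shows "segments J n ! Suc i = segments J n ! i + (if Suc i \<in> J then 1 else 0)"
proof -
  have "J \<inter> {..Suc i} = (if Suc i \<in> J then insert (Suc i) (J \<inter> {..i}) else J \<inter> {..i})"
    by (auto simp: le_Suc_eq)
  with assms show ?thesis
    by (simp add: segments_def)
qed

lemma sorted_segments: "sorted (segments J n)"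
  unfolding sorted_iff_nth_Suc by (auto simp: segments_Suc)

lemma inj_segment_key:
  assumes "step_rank r"
  shows "inj (segment_key r)"
proof (rule injI)
  fix p q assume "segment_key r p = segment_key r q"
  then have *: "3 * fst p + r (snd p) = 3 * fst q + r (snd q)"
    by (simp add: segment_key_def)
  have "r (snd p) < 3" "r (snd q) < 3" using assms by (auto simp: step_rank_def)
  with * have "fst p = fst q" "r (snd p) = r (snd q)" by presburger+
  with assms show "p = q"
    by (auto simp: step_rank_def prod_eq_iff dest: injD)
qed

text \<open>Sortedness concerns neighbours only. Inside a segment it forbids a drop in rank; at a
  boundary the segment number rises by 1, which outweighs any drop.\<close>

lemma sorted_segment_key_iff:
  assumes r: "step_rank r" and len: "length w = n"
  shows "sorted (map (segment_key r) (zip (segments J n) w)) \<longleftrightarrow> descents (rank_gt r) n w \<subseteq> J"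
proof -
  have step: "segment_key r (segments J n ! i, w ! i) \<le> segment_key r (segments J n ! Suc i, w ! Suc i)
      \<longleftrightarrow> (r (w ! Suc i) < r (w ! i) \<longrightarrow> Suc i \<in> J)" if "Suc i < n" for i
  proof -
    have "r (w ! i) < 3" "r (w ! Suc i) < 3" using r by (auto simp: step_rank_def)
    then show ?thesis
      using that by (auto simp: segment_key_def segments_Suc)
  qed
  have "sorted (map (segment_key r) (zip (segments J n) w)) \<longleftrightarrow>
      (\<forall>i. Suc i < n \<longrightarrow> r (w ! Suc i) < r (w ! i) \<longrightarrow> Suc i \<in> J)"
    using step len by (auto simp: sorted_iff_nth_Suc)
  also have "\<dots> \<longleftrightarrow> descents (rank_gt r) n w \<subseteq> J"
  proof
    assume *: "\<forall>i. Suc i < n \<longrightarrow> r (w ! Suc i) < r (w ! i) \<longrightarrow> Suc i \<in> J"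
    show "descents (rank_gt r) n w \<subseteq> J"
    proof
      fix i assume "i \<in> descents (rank_gt r) n w"
      with * show "i \<in> J" by (cases i) (auto simp: descents_def)
    qed
  qed (force simp: descents_def)
  finally show ?thesis .
qed

context
  fixes r :: "step \<Rightarrow> nat" and J :: "nat set" and w :: "step list"
  assumes r: "step_rank r"
begin

lemma mset_segment_sort: "mset (segment_sort r J w) = mset w"
  unfolding segment_sort_def by (metis length_segments map_snd_zip mset_map mset_sort)

lemma length_segment_sort [simp]: "length (segment_sort r J w) = length w"
  by (simp add: segment_sort_def)

text \<open>No letter leaves its segment: the first components after sorting are sorted and
  rearrange the already sorted \<open>segments\<close>, so they equal it.\<close>

lemma zip_segment_sort:
  "zip (segments J (length w)) (segment_sort r J w) =
     sort_key (segment_key r) (zip (segments J (length w)) w)" (is "_ = ?q")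
proof -
  have mono: "fst p \<le> fst q" if "segment_key r p \<le> segment_key r q" for p q
  proof -
    have "r (snd p) < 3" "r (snd q) < 3" using r by (auto simp: step_rank_def)
    with that show ?thesis by (simp add: segment_key_def)
  qed
  have "sorted (map (segment_key r) ?q)"
    by simp
  then have "sorted (map fst ?q)"
    unfolding sorted_map by (rule sorted_wrt_mono_rel[rotated]) (rule mono)
  moreover have "mset (map fst ?q) = mset (segments J (length w))"
    by (metis length_segments map_fst_zip mset_map mset_sort)
  ultimately have "map fst ?q = segments J (length w)"
    using sorted_segments by (metis properties_for_sort)
  then show ?thesis
    unfolding segment_sort_def by (metis zip_map_fst_snd)
qed

lemma descents_segment_sort: "descents (rank_gt r) (length w) (segment_sort r J w) \<subseteq> J"
  using sorted_segment_key_iff[OF r, of "segment_sort r J w" "length w" J]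
  by (simp add: zip_segment_sort)

context
  fixes r' :: "step \<Rightarrow> nat"
  assumes r': "step_rank r'" and sub: "descents (rank_gt r') (length w) w \<subseteq> J"
begin

text \<open>\<open>w\<close> is already sorted for \<open>r'\<close>, and for an injective key the
  sorted arrangement is unique.\<close>

lemma segment_sort_inverse: "segment_sort r' J (segment_sort r J w) = w"
proof -
  let ?z = "zip (segments J (length w)) w"
  have "sort_key (segment_key r') (sort_key (segment_key r) ?z) = ?z"
    by (rule sorted_map_inj_unique[OF _ _ _ inj_segment_key[OF r']])
      (use sub sorted_segment_key_iff[OF r'] in auto)
  then show ?thesis
    using zip_segment_sort by (simp add: segment_sort_def[of r'])
qed

text \<open>Both ranks put \<open>U\<close> above \<open>D\<close>, so the subword of these letters,
  sorted for \<open>r'\<close> segment by segment, is sorted for \<open>r\<close> as well and the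
  stable sort keeps it.\<close>

lemma filter_segment_sort:
  "filter (\<lambda>s. s \<noteq> L) (segment_sort r J w) = filter (\<lambda>s. s \<noteq> L) w"
proof -
  let ?z = "zip (segments J (length w)) w" and ?P = "\<lambda>p. snd p \<noteq> L"
  have mono: "segment_key r p \<le> segment_key r q"
    if "segment_key r' p \<le> segment_key r' q" "snd p \<noteq> L" "snd q \<noteq> L" for p q
  proof -
    have ranks: "r s < 3" "r' s < 3" "r D < r U" "r' D < r' U" for s
      using r r' by (auto simp: step_rank_def)
    have "r (snd p) \<le> r (snd q) \<longleftrightarrow> r' (snd p) \<le> r' (snd q)"
      using that(2,3) ranks(3,4) by (cases "snd p"; cases "snd q") auto
    then show ?thesis
      using that(1) ranks(1)[of "snd p"] ranks(1)[of "snd q"] ranks(2)[of "snd p"] ranks(2)[of "snd q"]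
      unfolding segment_key_def by arith
  qed
  have "sorted_wrt (\<lambda>p q. segment_key r' p \<le> segment_key r' q) (filter ?P ?z)"
    using sub sorted_segment_key_iff[OF r'] by (simp add: sorted_map sorted_wrt_filter)
  then have "sorted_wrt (\<lambda>p q. segment_key r p \<le> segment_key r q) (filter ?P ?z)"
    by (rule sorted_wrt_mono_rel[rotated]) (use mono in auto)
  then have "filter ?P (sort_key (segment_key r) ?z) = filter ?P ?z"
    by (simp add: filter_sort sort_key_id_if_sorted sorted_map)
  moreover have "map snd (filter ?P v) = filter (\<lambda>s. s \<noteq> L) (map snd v)" for v :: "(nat \<times> step) list"
    by (simp add: filter_map o_def)
  ultimately show ?thesis
    unfolding segment_sort_def by (metis length_segments map_snd_zip)
qed

end

end

text \<open>Resorting the segments is a bijection whose inverse resorts for the other rank. It keeps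
  the subword of \<open>U\<close> and \<open>D\<close>, hence the Motzkin condition, and the set of
  letters, so the all-\<open>L\<close> path stays excluded.\<close>

lemma card_descents_subset_eq:
  assumes r: "step_rank r" and r': "step_rank r'"
  shows "card {w \<in> motzkin_paths_star n. descents (rank_gt r) n w \<subseteq> J} =
         card {w \<in> motzkin_paths_star n. descents (rank_gt r') n w \<subseteq> J}"
proof -
  have len: "length w = n" if "w \<in> motzkin_paths_star n" for w
    using that by (simp add: motzkin_paths_star_eq)
  have maps: "segment_sort a J w \<in> {w \<in> motzkin_paths_star n. descents (rank_gt a) n w \<subseteq> J}"
    if "step_rank a" "step_rank b"
      "w \<in> {w \<in> motzkin_paths_star n. descents (rank_gt b) n w \<subseteq> J}" for a b w
  proof -
    have w: "length w = n" "w \<in> motzkin_paths_star n" "descents (rank_gt b) (length w) w \<subseteq> J"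
      using that(3) len by auto
    have "motzkin_from 0 (segment_sort a J w) \<longleftrightarrow> motzkin_from 0 w"
      using filter_segment_sort[OF that(1,2) w(3)] motzkin_from_filter by metis
    moreover have "set (segment_sort a J w) = set w"
      using mset_segment_sort[OF that(1)] by (metis set_mset_mset)
    ultimately show ?thesis
      using w descents_segment_sort[OF that(1), of w J] length_segment_sort[OF that(1), of J w]
      by (simp add: motzkin_paths_star_eq)
  qed
  have inverse: "segment_sort b J (segment_sort a J w) = w"
    if "step_rank a" "step_rank b"
      "w \<in> {w \<in> motzkin_paths_star n. descents (rank_gt b) n w \<subseteq> J}" for a b w
    using segment_sort_inverse[OF that(1,2), of w J] that(3) len by auto
  have "bij_betw (segment_sort r' J) {w \<in> motzkin_paths_star n. descents (rank_gt r) n w \<subseteq> J}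
      {w \<in> motzkin_paths_star n. descents (rank_gt r') n w \<subseteq> J}"
    by (rule bij_betw_byWitness[where f' = "segment_sort r J"])
      (use maps inverse r r' in blast)+
  then show ?thesis
    by (rule bij_betw_same_card)
qed

lemma cyclic_extension_rank_gt:
  assumes r: "step_rank r" and r': "step_rank r'"
    and ext: "has_cyclic_extension n (motzkin_paths_star n) (descents (rank_gt r) n)"
  shows "has_cyclic_extension n (motzkin_paths_star n) (descents (rank_gt r') n)"
proof -
  let ?M = "motzkin_paths_star n"
  have "card {w \<in> ?M. descents (rank_gt r') n w = J} = card {w \<in> ?M. descents (rank_gt r) n w = J}" for J
  proof (cases "finite J")
    case True
    then show ?thesis
      using card_fibres_eq_of_card_subset_eq[OF finite_motzkin_paths_star finite_motzkin_paths_star]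
        card_descents_subset_eq[OF r' r] by blast
  next
    \<comment> \<open>Inversion covers finite \<open>J\<close>; as descent sets are finite, both
      fibres over an infinite \<open>J\<close> are empty.\<close>
    case False
    have "finite (descents g n w)" for g w
      by (simp add: descents_def)
    with False have "descents g n w \<noteq> J" for g w
      by metis
    then show ?thesis by simp
  qed
  then have "\<exists>h. bij_betw h ?M ?M \<and>
      (\<forall>w\<in>?M. descents (rank_gt r) n (h w) = descents (rank_gt r') n w)"
    by (rule bij_betw_of_card_fibres_eq[OF finite_motzkin_paths_star finite_motzkin_paths_star])
  then obtain h where "bij_betw h ?M ?M"
      "\<And>w. w \<in> ?M \<Longrightarrow> descents (rank_gt r) n (h w) = descents (rank_gt r') n w"
    by blast
  with ext show ?thesis
    by (rule has_cyclic_extension_transfer)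
qed

section \<open>From chain orders to ranks\<close>

lemma distinct_steps_exhaust:
  fixes s :: step
  assumes "distinct [a, b, c]"
  shows "s = a \<or> s = b \<or> s = c"
  using assms by (cases s; cases a; cases b; cases c) auto

lemma chain_gt_eq_rank_gt:
  assumes "distinct [a, b, c]"
  shows "chain_gt a b c = rank_gt (\<lambda>s. if s = a then 2 else if s = b then 1 else 0)"
proof (intro ext)
  fix s t
  have neq: "a \<noteq> b" "b \<noteq> a" "a \<noteq> c" "c \<noteq> a" "b \<noteq> c" "c \<noteq> b"
    using assms by auto
  show "chain_gt a b c s t =
      ((if t = a then 2 else if t = b then 1 else 0) < (if s = a then 2 else if s = b then 1 else (0::nat)))"
    using distinct_steps_exhaust[OF assms, of s] distinct_steps_exhaust[OF assms, of t]
    by (elim disjE) (simp_all add: chain_gt_def neq)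
qed

lemma step_rank_chain:
  assumes "distinct [a, b, c]" "chain_gt a b c U D"
  shows "step_rank (\<lambda>s. if s = a then 2 else if s = b then 1 else 0)"
proof -
  let ?r = "\<lambda>s. if s = a then 2 else if s = b then 1 else (0::nat)"
  have "x = y" if "?r x = ?r y" for x y
    using that distinct_steps_exhaust[OF assms(1), of x] distinct_steps_exhaust[OF assms(1), of y]
    by (simp split: if_splits)
  then have "inj ?r"
    by (rule injI)
  with assms show ?thesis
    by (auto simp: step_rank_def chain_gt_def)
qed

theorem proposition3p3:
  fixes n :: nat and gt :: "step \<Rightarrow> step \<Rightarrow> bool"
  assumes "n \<ge> 3"
    and "gt \<in> {chain_gt U D L, chain_gt U L D, chain_gt L U D}"
  shows "has_cyclic_extension n (motzkin_paths_star n) (descents gt n)"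
proof -
  \<comment> \<open>All orders with \<open>U\<close> above \<open>D\<close> are handled at once by
    comparison with \<open>L > U > D\<close>.\<close>
  have "has_cyclic_extension n (motzkin_paths_star n) (descents (chain_gt a b c) n)"
    if "distinct [a, b, c]" "chain_gt a b c U D" for a b c
  proof -
    have LUD: "distinct [L, U, D]" "chain_gt L U D U D"
      by (simp_all add: chain_gt_def)
    show ?thesis
      using cyclic_extension_rank_gt[OF step_rank_chain[OF LUD] step_rank_chain[OF that]]
        cyclic_extension_LUD[OF assms(1)]
      unfolding chain_gt_eq_rank_gt[OF that(1)] chain_gt_eq_rank_gt[OF LUD(1)] .
  qed
  from this[of U D L] this[of U L D] this[of L U D] assms(2) show ?thesis
    by (auto simp: chain_gt_def)
qed

end
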